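(* Let $E$ be a finite set and $d\ge 1$. Let $A\in\mathbb T^{d\times E}$ be a matrix presentation of a valuated matroid $\mu$ of rank $d$ on $E$, i.e. $\mu=\pi(A)$. For $x\in\mathbb T^d$ let $(A|x)\in\mathbb T^{d\times(E\sqcup\{*\})}$ be the matrix obtained from $A$ by appending $x$ as a new column indexed by a new element $*$. Then the valuated matroids $\pi(A|x)$, for $x\in\mathbb T^d$, are pairwise different (i.e. $x\neq y$ implies $\pi(A|x)\neq\pi(A|y)$ as valuated matroids) if and only if $A$ is a minimal matrix presentation of $\mu$.
   Context: $\mathbb T=\mathbb R\cup\{\infty\}$ with operations $\min$ and $+$. A valuated matroid of rank $d$ on a finite set $E$ is a function $\mu:\binom Ed\to\mathbb T$ such that $\mu^{-1}(\mathbb R)$ is the set of bases of a matroid $\underline{\mu}$ (the underlying matroid) and for all $S\in\binom E{d-2}$ and $i,j,k,l\notin S$ the minimum of $\mu_{Sij}+\mu_{Skl},\ \mu_{Sik}+\mu_{Sjl},\ \mu_{Sil}+\mu_{Sjk}$ is attained at least twice; two such functions differing by a global additive real constant are regarded as the same valuated matroid. The tropical Stiefel map $\pi$ sends a matrix $A\in\mathbb T^{d\times E}$ with rows $A_1,\dots,A_d$ to the function $B\mapsto\min\{\sum_{i\in B}A_{\phi(i),i}:\phi:B\to[d]\text{ a bijection}\}$ on $\binom Ed$; whenever this is not identically $\infty$ it is a valuated matroid. A matrix presentation of $\mu$ is a matrix $A$ with $\pi(A)=\mu$. The support of a vector $y\in\mathbb T^E$ is $\{j:y_j\neq\infty\}$.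 For a (nonvaluated) transversal matroid $M$ of rank $d$, a presentation is a multiset $\{\!\{A_1,\dots,A_d\}\!\}$ of subsets of $E$ such that the bases of $M$ are exactly the $d$-subsets of $E$ admitting a perfect matching to $[d]$ in the bipartite graph where $i\in[d]$ is adjacent to the elements of $A_i$; presentations are ordered by $\mathcal A\le\mathcal A'$ if there is a bijection $f:\mathcal A\to\mathcal A'$ with $X\subseteq f(X)$ for all $X$, and a minimal presentation is a minimal one in this order (equivalently, every $A_i$ is a cocircuit of $M$). A matrix presentation $A$ of $\mu$ is called minimal if the multiset of supports of its rows is a minimal presentation of $\underline{\mu}$. *)

theory Defs
  imports "HOL-Library.Extended_Real" "HOL-Library.Multiset" "HOL-Library.FuncSet"
begin

text \<open>The tropical semiring \<open>\<real> \<union> {\<infinity>}\<close>, as the subset of \<^typ>\<open>ereal\<close> without \<open>-\<infinity>\<close>. On it, the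
  order, addition and minimum of \<^typ>\<open>ereal\<close> are the intended ones.\<close>

definition trop :: "ereal set" where
  "trop = {-\<infinity><..}"

definition matroid_bases :: "'a set \<Rightarrow> 'a set set \<Rightarrow> bool" where
  "matroid_bases E \<B> \<longleftrightarrow> finite E \<and> \<B> \<noteq> {} \<and> (\<forall>B\<in>\<B>. B \<subseteq> E) \<and>
     (\<forall>B\<in>\<B>. \<forall>B'\<in>\<B>. \<forall>x\<in>B - B'. \<exists>y\<in>B' - B. insert y (B - {x}) \<in> \<B>)"

definition subsets_of_card :: "nat \<Rightarrow> 'a set \<Rightarrow> 'a set set" where
  "subsets_of_card d E = {B. B \<subseteq> E \<and> card B = d}"

text \<open>A function on the \<open>d\<close>-subsets of \<open>E\<close> is a total function on sets of which only the values at
  \<^term>\<open>subsets_of_card d E\<close> matter.\<close>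

definition underlying_bases :: "nat \<Rightarrow> 'a set \<Rightarrow> ('a set \<Rightarrow> ereal) \<Rightarrow> 'a set set" where
  "underlying_bases d E \<mu> = {B \<in> subsets_of_card d E. \<mu> B \<noteq> \<infinity>}"

definition min_attained_twice :: "ereal \<Rightarrow> ereal \<Rightarrow> ereal \<Rightarrow> bool" where
  "min_attained_twice a b c \<longleftrightarrow> (a = b \<and> a \<le> c) \<or> (a = c \<and> a \<le> b) \<or> (b = c \<and> b \<le> a)"

text \<open>The condition \<open>card S + 2 = d\<close> expresses \<open>|S| = d - 2\<close> without truncated subtraction, so that
  the exchange relation is vacuous for \<open>d < 2\<close>.\<close>

definition valuated_matroid :: "nat \<Rightarrow> 'a set \<Rightarrow> ('a set \<Rightarrow> ereal) \<Rightarrow> bool" where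
  "valuated_matroid d E \<mu> \<longleftrightarrow>
     (\<forall>B\<in>subsets_of_card d E. \<mu> B \<in> trop) \<and>
     matroid_bases E (underlying_bases d E \<mu>) \<and>
     (\<forall>S i j k l. S \<subseteq> E \<and> card S + 2 = d \<and> {i, j, k, l} \<subseteq> E - S \<and> distinct [i, j, k, l] \<longrightarrow>
        min_attained_twice
          (\<mu> (S \<union> {i, j}) + \<mu> (S \<union> {k, l}))
          (\<mu> (S \<union> {i, k}) + \<mu> (S \<union> {j, l}))
          (\<mu> (S \<union> {i, l}) + \<mu> (S \<union> {j, k})))"

definition same_valuated_matroid ::
    "nat \<Rightarrow> 'a set \<Rightarrow> ('a set \<Rightarrow> ereal) \<Rightarrow> ('a set \<Rightarrow> ereal) \<Rightarrow> bool" where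
  "same_valuated_matroid d E \<mu> \<nu> \<longleftrightarrow>
     (\<exists>c::real. \<forall>B\<in>subsets_of_card d E. \<mu> B = \<nu> B + ereal c)"

text \<open>A matrix with rows indexed by \<open>{1..d}\<close> and columns indexed by \<open>E\<close> is a total function
  \<open>A row column\<close> whose values outside \<open>{1..d} \<times> E\<close> are irrelevant.\<close>

definition stiefel_map :: "nat \<Rightarrow> (nat \<Rightarrow> 'a \<Rightarrow> ereal) \<Rightarrow> 'a set \<Rightarrow> ereal" where
  "stiefel_map d A B =
     Min {\<Sum>i\<in>B. A (\<phi> i) i |\<phi>. \<phi> \<in> B \<rightarrow>\<^sub>E {1..d} \<and> bij_betw \<phi> B {1..d}}"

definition matrix_presentation ::
    "nat \<Rightarrow> 'a set \<Rightarrow> (nat \<Rightarrow> 'a \<Rightarrow> ereal) \<Rightarrow> ('a set \<Rightarrow> ereal) \<Rightarrow> bool" where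
  "matrix_presentation d E A \<mu> \<longleftrightarrow>
     (\<forall>i\<in>{1..d}. \<forall>j\<in>E. A i j \<in> trop) \<and> same_valuated_matroid d E (stiefel_map d A) \<mu>"

text \<open>Presentations of the rank-\<open>d\<close> matroid on \<open>E\<close> with set of bases \<open>\<B>\<close>. The family \<open>F\<close> merely
  enumerates the multiset; the set of matchable subsets does not depend on the enumeration.\<close>

definition transversal_presentation ::
    "nat \<Rightarrow> 'a set \<Rightarrow> 'a set set \<Rightarrow> 'a set multiset \<Rightarrow> bool" where
  "transversal_presentation d E \<B> \<A> \<longleftrightarrow>
     (\<exists>F. \<A> = image_mset F (mset_set {1..d}) \<and> (\<forall>i\<in>{1..d}. F i \<subseteq> E) \<and>
        \<B> = {B \<in> subsets_of_card d E. \<exists>\<phi>. bij_betw \<phi> B {1..d} \<and> (\<forall>b\<in>B. b \<in> F (\<phi> b))})"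

text \<open>\<^term>\<open>rel_mset (\<subseteq>) \<A>' \<A>\<close> says that some bijection between the multisets maps each member
  of \<open>\<A>'\<close> to a superset.\<close>

definition minimal_transversal_presentation ::
    "nat \<Rightarrow> 'a set \<Rightarrow> 'a set set \<Rightarrow> 'a set multiset \<Rightarrow> bool" where
  "minimal_transversal_presentation d E \<B> \<A> \<longleftrightarrow>
     transversal_presentation d E \<B> \<A> \<and>
     (\<forall>\<A>'. transversal_presentation d E \<B> \<A>' \<and> rel_mset (\<subseteq>) \<A>' \<A> \<longrightarrow> \<A>' = \<A>)"

definition vec_support :: "'a set \<Rightarrow> ('a \<Rightarrow> ereal) \<Rightarrow> 'a set" where
  "vec_support E y = {j \<in> E. y j \<noteq> \<infinity>}"

definition minimal_matrix_presentation ::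
    "nat \<Rightarrow> 'a set \<Rightarrow> (nat \<Rightarrow> 'a \<Rightarrow> ereal) \<Rightarrow> ('a set \<Rightarrow> ereal) \<Rightarrow> bool" where
  "minimal_matrix_presentation d E A \<mu> \<longleftrightarrow>
     matrix_presentation d E A \<mu> \<and>
     minimal_transversal_presentation d E (underlying_bases d E \<mu>)
       (image_mset (\<lambda>i. vec_support E (A i)) (mset_set {1..d}))"

text \<open>The disjoint union \<open>E \<squnion> {*}\<close> is \<^term>\<open>extend_ground E\<close>, with \<^term>\<open>None\<close> as the new
  element.\<close>

definition extend_ground :: "'a set \<Rightarrow> 'a option set" where
  "extend_ground E = insert None (Some ` E)"

definition append_column ::
    "(nat \<Rightarrow> 'a \<Rightarrow> ereal) \<Rightarrow> (nat \<Rightarrow> ereal) \<Rightarrow> nat \<Rightarrow> 'a option \<Rightarrow> ereal" where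
  "append_column A x i e = (case e of None \<Rightarrow> x i | Some j \<Rightarrow> A i j)"

end

theory Submission
  imports Defs "HOL-Combinatorics.Permutations"
begin

text \<open>Write \<open>S i\<close> for the support of row \<open>i\<close> of \<open>A\<close>. On a set \<open>J \<union> {*}\<close> with \<open>|J| = d - 1\<close> the
  function \<open>\<pi>(A|x)\<close> takes the value \<open>min\<^sub>i (x i + p\<^sub>i(J))\<close>, where \<open>p\<^sub>i\<close> is the image under \<open>\<pi>\<close> of \<open>A\<close>
  without row \<open>i\<close>. Such a tropical linear map is injective iff each \<open>x i\<close> can be read off from some
  \<open>J\<close> with \<open>p\<^sub>k(J) = \<infinity>\<close> for all \<open>k \<noteq> i\<close>, \<open>p\<^sub>i(J)\<close> being finite. A matching of \<open>J\<close> avoiding row \<open>i\<close>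
  can be rerouted through any element of \<open>J \<inter> S i\<close>, so this means that some \<open>J\<close> disjoint from \<open>S i\<close>
  is matchable to the other rows, i.e. that \<open>S i\<close> is a cocircuit; and a presentation is minimal iff
  all its members are cocircuits.\<close>

section \<open>Matchable sets\<close>

text \<open>Partial transversals, that is, independent sets of the transversal matroid: an
  injection, not a bijection, so that sets smaller than a basis are covered. Keeping
  \<open>R\<close> apart from \<open>S\<close> allows a row to be deleted.\<close>

definition matchable :: "'b set \<Rightarrow> ('b \<Rightarrow> 'a set) \<Rightarrow> 'a set \<Rightarrow> bool" where
  "matchable R S I \<longleftrightarrow> (\<exists>f. inj_on f I \<and> (\<forall>x\<in>I. f x \<in> R \<and> x \<in> S (f x)))"

lemma matchable_subset: "matchable R S I \<Longrightarrow> J \<subseteq> I \<Longrightarrow> matchable R S J"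
  unfolding matchable_def by (meson inj_on_subset subsetD)

lemma matchable_mono:
  "matchable R S I \<Longrightarrow> R \<subseteq> R' \<Longrightarrow> (\<And>i. i \<in> R \<Longrightarrow> S i \<inter> I \<subseteq> S' i) \<Longrightarrow> matchable R' S' I"
  unfolding matchable_def by (meson IntI subsetD)

lemma matchable_insert:
  assumes "matchable (R - {i}) S I" "i \<in> R" "x \<in> S i"
  shows "matchable R S (insert x I)"
proof (cases "x \<in> I")
  case True
  then show ?thesis using assms(1) by (auto simp: insert_absorb elim: matchable_mono)
next
  case False
  obtain f where f: "inj_on f I" "\<forall>y\<in>I. f y \<in> R - {i} \<and> y \<in> S (f y)"
    using assms(1) unfolding matchable_def by blast
  have "inj_on (f(x := i)) (insert x I)"
    using f False by (auto simp: inj_on_def)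
  then show ?thesis
    unfolding matchable_def using f False assms(2,3) by (intro exI[of _ "f(x := i)"]) auto
qed

lemma matchable_iff_bij_betw:
  assumes "finite B" "finite R" "card B = card R"
  shows "matchable R S B \<longleftrightarrow> (\<exists>\<phi>. bij_betw \<phi> B R \<and> (\<forall>b\<in>B. b \<in> S (\<phi> b)))"
proof
  assume "matchable R S B"
  then obtain f where f: "inj_on f B" "\<forall>x\<in>B. f x \<in> R \<and> x \<in> S (f x)"
    unfolding matchable_def by blast
  then have "f ` B = R"
    using assms by (intro card_subset_eq) (auto simp: card_image)
  then show "\<exists>\<phi>. bij_betw \<phi> B R \<and> (\<forall>b\<in>B. b \<in> S (\<phi> b))"
    using f by (auto simp: bij_betw_def)
qed (auto simp: matchable_def bij_betw_def)

text \<open>Matroid augmentation by alternating paths. By counting, \<open>g\<close> uses a row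
  \<open>g x\<close> that \<open>f\<close> leaves free. If \<open>x\<close> is outside
  \<open>I\<close>, it can be added with that row; otherwise \<open>x\<close> is moved to
  \<open>g x\<close>, and \<open>f\<close> disagrees with \<open>g\<close> at fewer elements of
  \<open>I\<close> and \<open>J\<close>.\<close>

lemma matchable_augment:
  assumes "finite I" "finite J" "card I < card J" "matchable R S I" "matchable R S J"
  shows "\<exists>x\<in>J - I. matchable R S (insert x I)"
proof -
  obtain g where g: "inj_on g J" "\<forall>x\<in>J. g x \<in> R \<and> x \<in> S (g x)"
    using assms(5) unfolding matchable_def by blast
  have "\<exists>x\<in>J - I. matchable R S (insert x I)"
    if "inj_on f I" "\<forall>x\<in>I. f x \<in> R \<and> x \<in> S (f x)" for f
    using that
  proof (induction "card {x \<in> I \<inter> J. f x \<noteq> g x}" arbitrary: f rule: less_induct)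
    case less
    have "card (f ` I) < card (g ` J)"
      using less.prems g assms(3) by (simp add: card_image)
    then have "\<not> g ` J \<subseteq> f ` I"
      using assms(1) by (meson card_mono finite_imageI not_le)
    then obtain x where x: "x \<in> J" "g x \<notin> f ` I" by blast
    let ?f = "f(x := g x)"
    have "?f ` (I - {x}) \<subseteq> f ` I" by auto
    moreover have "inj_on ?f I" using less.prems(1) x(2) by (rule inj_on_fun_updI)
    ultimately have "inj_on ?f (insert x I)" using x(2) by auto
    moreover have "\<forall>y\<in>insert x I. ?f y \<in> R \<and> y \<in> S (?f y)"
      using less.prems(2) g(2) x(1) by simp
    ultimately have f: "inj_on ?f (insert x I)" "\<forall>y\<in>insert x I. ?f y \<in> R \<and> y \<in> S (?f y)"
      by blast+
    show ?case
    proof (cases "x \<in> I")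
      case False
      then show ?thesis using x f unfolding matchable_def by blast
    next
      case True
      have "{y \<in> I \<inter> J. ?f y \<noteq> g y} \<subset> {y \<in> I \<inter> J. f y \<noteq> g y}"
        using True x by force
      then have "card {y \<in> I \<inter> J. ?f y \<noteq> g y} < card {y \<in> I \<inter> J. f y \<noteq> g y}"
        using assms(1) by (intro psubset_card_mono) auto
      then show ?thesis
        using f unfolding insert_absorb[OF True] by (rule less.hyps)
    qed
  qed
  with assms(4) show ?thesis unfolding matchable_def[of R S I] by (elim exE conjE)
qed

lemma matchable_extend:
  assumes "finite I" "finite J" "card I \<le> card J" "matchable R S I" "matchable R S J"
  obtains X where "I \<subseteq> X" "X \<subseteq> I \<union> J" "card X = card J" "matchable R S X"
proof -
  have "\<exists>X. I \<subseteq> X \<and> X \<subseteq> I \<union> J \<and> card X = card J \<and> matchable R S X"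
    using assms(1,3,4)
  proof (induction "card J - card I" arbitrary: I)
    case 0
    then show ?case by (intro exI[of _ I]) auto
  next
    case (Suc n)
    then have "card I < card J" by simp
    then obtain x where x: "x \<in> J - I" "matchable R S (insert x I)"
      using matchable_augment[OF Suc.prems(1) assms(2) _ Suc.prems(3) assms(5)] by blast
    have "\<exists>X. insert x I \<subseteq> X \<and> X \<subseteq> insert x I \<union> J \<and> card X = card J \<and> matchable R S X"
      using Suc.hyps(2) Suc.prems x by (intro Suc.hyps(1)) auto
    then show ?case using x by blast
  qed
  then show ?thesis by (elim exE conjE) (rule that)
qed

section \<open>Minimal presentations\<close>

text \<open>In matroid language: if the complement of \<open>S i\<close> is not of rank \<open>|R| - 1\<close>, then \<open>S i\<close> is not a
  cocircuit and some element of it is redundant. The element is found in the transversal matroid of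
  the rows other than \<open>i\<close>: it lies outside the closure of the complement of \<open>S i\<close>.\<close>

lemma redundant_element:
  assumes "finite E" "finite R" "i \<in> R"
    and B0: "B0 \<subseteq> E" "card B0 = card R" "matchable R S B0"
    and no: "\<And>J. J \<subseteq> E - S i \<Longrightarrow> Suc (card J) = card R \<Longrightarrow> \<not> matchable (R - {i}) S J"
  shows "\<exists>z\<in>S i. \<forall>B. B \<subseteq> E \<and> card B = card R \<and> matchable R S B \<longrightarrow>
    matchable R (S(i := S i - {z})) B"
proof -
  let ?N = "matchable (R - {i}) S"
  have fin: "finite X" if "X \<subseteq> E" for X
    using that assms(1) by (rule finite_subset)
  \<comment> \<open>\<open>b\<close> is the element matched to row \<open>i\<close>. The remaining
    matching avoids row \<open>i\<close>, and if \<open>b\<close> is not \<open>z\<close> the whole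
    matching survives removing \<open>z\<close> from \<open>S i\<close>.\<close>
  have del: "\<exists>b\<in>B \<inter> S i. ?N (B - {b}) \<and>
      (matchable R (S(i := S i - {z})) B \<or> b = z)"
    if B: "B \<subseteq> E" "card B = card R" "matchable R S B" for B z
  proof -
    obtain \<phi> where \<phi>: "bij_betw \<phi> B R" "\<forall>b\<in>B. b \<in> S (\<phi> b)"
      using matchable_iff_bij_betw[OF fin[OF B(1)] assms(2) B(2)] B(3) by blast
    then obtain b where b: "b \<in> B" "\<phi> b = i" using assms(3) by (auto simp: bij_betw_def)
    have n: "\<phi> x \<noteq> i" if "x \<in> B" "x \<noteq> b" for x
      using \<phi>(1) b that by (auto simp: bij_betw_def inj_on_def)
    have "?N (B - {b})"
      unfolding matchable_def using \<phi> n
      by (intro exI[of _ \<phi>]) (auto simp: bij_betw_def inj_on_def)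
    moreover have "matchable R (S(i := S i - {z})) B" if "b \<noteq> z"
      unfolding matchable_def using \<phi> n b that
      by (intro exI[of _ \<phi>]) (auto simp: bij_betw_def)
    ultimately show ?thesis using b \<phi> by blast
  qed
  define P where "P X \<longleftrightarrow> X \<subseteq> E - S i \<and> ?N X" for X
  have "P {}" by (auto simp: P_def matchable_def)
  moreover have "\<forall>X. P X \<longrightarrow> card X < Suc (card E)"
    using assms(1) by (auto simp: P_def less_Suc_eq_le intro!: card_mono)
  ultimately have "\<exists>I. P I \<and> (\<forall>X. P X \<longrightarrow> card X \<le> card I)"
    by (rule ex_has_greatest_nat[where f = card])
  then obtain I where I: "P I" and "\<forall>X. P X \<longrightarrow> card X \<le> card I" by (elim exE conjE)
  then have max: "\<And>X. P X \<Longrightarrow> card X \<le> card I" by blast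
  have finI: "finite I" using I by (auto simp: P_def intro: fin)
  obtain b0 where b0: "b0 \<in> B0" "?N (B0 - {b0})"
    using del[OF B0] by blast
  then have cb0: "Suc (card (B0 - {b0})) = card R"
    using card_Suc_Diff1[OF fin[OF B0(1)]] B0(2) by simp
  \<comment> \<open>A larger \<open>I\<close> would contain a set of size \<open>card R - 1\<close>,
    which \<open>no\<close> forbids.\<close>
  have "card I < card (B0 - {b0})"
  proof (rule ccontr)
    assume "\<not> ?thesis"
    then obtain J where "J \<subseteq> I" "card J = card (B0 - {b0})"
      by (meson not_less obtain_subset_with_card_n)
    then show False using no[of J] I cb0 matchable_subset[of _ S I J] by (auto simp: P_def)
  qed
  \<comment> \<open>The redundant element arises by augmenting the maximal \<open>I\<close> from
    \<open>B0 - {b0}\<close> without row \<open>i\<close>; maximality of \<open>I\<close> forces it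
    into \<open>S i\<close>.\<close>
  then obtain z where z: "z \<in> B0 - {b0} - I" "?N (insert z I)"
    using matchable_augment[of I "B0 - {b0}" "R - {i}" S] I b0(2) finI fin[OF B0(1)]
    by (auto simp: P_def)
  have zS: "z \<in> S i"
  proof (rule ccontr)
    assume "z \<notin> S i"
    then have "P (insert z I)" using z I B0 by (auto simp: P_def)
    then show False using max[of "insert z I"] z finI by simp
  qed
  have "matchable R (S(i := S i - {z})) B"
    if B: "B \<subseteq> E" "card B = card R" "matchable R S B" for B
  proof (rule ccontr)
    assume neg: "\<not> ?thesis"
    then have zB: "z \<in> B" "?N (B - {z})" using del[OF B, of z] by auto
    define G where "G = B - S i"
    have G: "P G" "finite G"
      using zS B(1) fin[OF B(1)] unfolding G_def P_def
      by (auto intro: matchable_subset[OF zB(2)])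
    \<comment> \<open>\<open>X\<close> has one element more than the maximal \<open>I\<close>, so it
      cannot avoid \<open>S i\<close> and must use \<open>z\<close>. Hence \<open>z\<close> can be
      added to \<open>G\<close> as well.\<close>
    obtain X where X: "G \<subseteq> X" "X \<subseteq> G \<union> insert z I" "card X = card (insert z I)" "?N X"
      using matchable_extend[of G "insert z I" "R - {i}" S] G z finI max[OF G(1)]
      by (auto simp: P_def)
    have "z \<in> X"
    proof (rule ccontr)
      assume "z \<notin> X"
      then have "P X" using X G I by (auto simp: P_def)
      then show False using max[of X] X z finI by simp
    qed
    then have Gz: "?N (insert z G)" using X matchable_subset by blast
    have cB: "Suc (card (B - {z})) = card R" using card_Suc_Diff1[OF fin[OF B(1)] zB(1)] B(2) by simp
    have "card (insert z G) \<le> card (B - {z})"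
    proof -
      have "card (insert z G) \<le> Suc (card G)" using G by (simp add: card_insert_if)
      also have "\<dots> \<le> Suc (card I)" using max[OF G(1)] by simp
      also have "\<dots> \<le> card (B - {z})" using \<open>card I < _\<close> cb0 cB by simp
      finally show ?thesis .
    qed
    \<comment> \<open>\<open>D\<close> contains \<open>z\<close> and everything in \<open>B\<close>
      outside \<open>S i\<close>. The one element \<open>w\<close> of \<open>B\<close> that it
      misses therefore lies in \<open>S i - {z}\<close> and can take row \<open>i\<close>, which
      gives the matching denied by \<open>neg\<close>.\<close>
    then obtain D where D: "insert z G \<subseteq> D" "D \<subseteq> insert z G \<union> (B - {z})"
        "card D = card (B - {z})" "?N D"
      using matchable_extend[of "insert z G" "B - {z}" "R - {i}" S] Gz zB(2) G(2) fin[OF B(1)] by auto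
    have DB: "D \<subseteq> B" using D zB by (auto simp: G_def)
    have "card D < card B" using D(3) cB B by simp
    then obtain w where w: "w \<in> B" "w \<notin> D" using DB by (metis less_irrefl subsetI subset_antisym)
    have "insert w D = B"
      using w DB D(3) cB B(2) fin[OF B(1)] finite_subset[OF DB] by (intro card_subset_eq) auto
    moreover have "w \<in> S i - {z}" using w D by (auto simp: G_def)
    moreover have "matchable (R - {i}) (S(i := S i - {z})) D"
      using D(4) by (rule matchable_mono) auto
    ultimately show False
      using neg matchable_insert[of R i "S(i := S i - {z})" D w] assms(3) by simp
  qed
  then show ?thesis using zS by blast
qed

section \<open>Presentations as multisets, and their minimality\<close>

lemma transversal_presentation_image:
  assumes "finite E" "\<And>i. i \<in> {1..d} \<Longrightarrow> F i \<subseteq> E"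
    "\<B> = {B \<in> subsets_of_card d E. matchable {1..d} F B}"
  shows "transversal_presentation d E \<B> (image_mset F (mset_set {1..d}))"
  unfolding transversal_presentation_def
proof (intro exI conjI)
  show "\<B> = {B \<in> subsets_of_card d E. \<exists>\<phi>. bij_betw \<phi> B {1..d} \<and> (\<forall>b\<in>B. b \<in> F (\<phi> b))}"
    unfolding assms(3) subsets_of_card_def
    using matchable_iff_bij_betw[of _ "{1..d}" F] assms(1) by (auto dest: finite_subset)
qed (use assms in auto)

lemma rel_mset_image_subset:
  assumes "\<And>i. i \<in> K \<Longrightarrow> F i \<subseteq> G i" "finite K"
  shows "rel_mset (\<subseteq>) (image_mset F (mset_set K)) (image_mset G (mset_set K))"
  unfolding multiset.rel_map
  using assms by (intro multiset.rel_refl_strong) auto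

text \<open>Turns a bijection of multisets into one of indices. The larger side is listed in the
  order of \<open>G\<close>; the smaller side, reordered along with it, enumerates the same multiset
  as \<open>F\<close>, so it is \<open>F\<close> composed with a permutation.\<close>

lemma rel_mset_subset_imageE:
  assumes "rel_mset (\<subseteq>) (image_mset F (mset_set {1..d})) (image_mset G (mset_set {1..d::nat}))"
  obtains p where "p permutes {1..d}" "\<And>i. i \<in> {1..d} \<Longrightarrow> F (p i) \<subseteq> G i"
proof -
  have eq: "mset (map G [1..<Suc d]) = image_mset G (mset_set {1..d})"
    by (simp del: upt_Suc add: atLeastLessThanSuc_atLeastAtMost)
  obtain xs ys where xy: "mset xs = image_mset F (mset_set {1..d})"
      "mset ys = image_mset G (mset_set {1..d})" "list_all2 (\<subseteq>) xs ys"
    using assms unfolding rel_mset_def by blast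
  \<comment> \<open>The relation is flipped because the reordering lemma rearranges the left
    list.\<close>
  have "list_all2 (\<supseteq>) ys xs" using xy(3) by (simp add: list_all2_conv_all_nth)
  then obtain zs where "list_all2 (\<supseteq>) (map G [1..<Suc d]) zs" and zs2: "mset zs = mset xs"
    using list_all2_reorder_left_invariance[of "(\<supseteq>)" ys xs "map G [1..<Suc d]"] eq xy(2) by metis
  then have zs: "list_all2 (\<subseteq>) zs (map G [1..<Suc d])"
    by (simp del: upt_Suc add: list_all2_conv_all_nth)
  have len: "length zs = d" using zs by (auto dest: list_all2_lengthD)
  \<comment> \<open>Rows are counted from 1, list positions from 0.\<close>
  define H where "H i = zs ! (i - 1)" for i
  have "map H [1..<Suc d] = zs"
    by (rule nth_equalityI) (use len in \<open>auto simp del: upt_Suc simp: H_def\<close>)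
  then have "image_mset H (mset_set {1..d}) = image_mset F (mset_set {1..d})"
    using zs2 xy(1) by (metis mset_map mset_upt atLeastLessThanSuc_atLeastAtMost)
  then obtain p where p: "p permutes {1..d}" "\<forall>i\<in>{1..d}. H i = F (p i)"
    using image_mset_eq_implies_permutes[of "{1..d}" H F] by auto
  have "H i \<subseteq> G i" if "i \<in> {1..d}" for i
  proof -
    have "i - 1 < length zs" "1 + (i - 1) = i" using that len by auto
    then show ?thesis
      using list_all2_nthD[OF zs, of "i - 1"] len by (simp del: upt_Suc add: H_def)
  qed
  then show ?thesis using that p by simp
qed

text \<open>The condition on \<open>J\<close> says that \<open>S i\<close> is a cocircuit. If it
  fails, removing a redundant element gives a strictly smaller presentation. If it holds, adding any
  element of \<open>S i\<close> to \<open>J\<close> gives a basis, so no smaller presentation can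
  drop that element.\<close>

lemma minimal_transversal_presentation_iff:
  fixes S :: "nat \<Rightarrow> 'a set"
  assumes "finite E" and S: "\<And>i. i \<in> {1..d} \<Longrightarrow> S i \<subseteq> E"
    and B: "\<B> = {B \<in> subsets_of_card d E. matchable {1..d} S B}" "\<B> \<noteq> {}"
  shows "minimal_transversal_presentation d E \<B> (image_mset S (mset_set {1..d})) \<longleftrightarrow>
    (\<forall>i\<in>{1..d}. \<exists>J \<subseteq> E - S i. Suc (card J) = d \<and> matchable ({1..d} - {i}) S J)"
    (is "?min \<longleftrightarrow> ?C")
proof
  assume min: ?min
  show ?C
  proof (rule ccontr)
    assume "\<not> ?C"
    then obtain i where i: "i \<in> {1..d}"
      and no: "\<And>J. J \<subseteq> E - S i \<Longrightarrow> Suc (card J) = d \<Longrightarrow> \<not> matchable ({1..d} - {i}) S J" by blast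
    obtain B0 where B0: "B0 \<subseteq> E" "card B0 = d" "matchable {1..d} S B0"
      using B by (auto simp: subsets_of_card_def)
    have "\<exists>z\<in>S i. \<forall>B. B \<subseteq> E \<and> card B = card {1..d} \<and> matchable {1..d} S B \<longrightarrow>
        matchable {1..d} (S(i := S i - {z})) B"
      by (rule redundant_element[of _ _ _ B0]) (use assms(1) i B0 no in simp_all)
    then obtain z where z: "z \<in> S i" and red: "\<forall>B. B \<subseteq> E \<and> card B = d \<and> matchable {1..d} S B \<longrightarrow>
        matchable {1..d} (S(i := S i - {z})) B"
      by auto
    let ?S = "S(i := S i - {z})"
    have "matchable {1..d} S B" if "matchable {1..d} ?S B" for B
      using that by (rule matchable_mono) (auto split: if_splits)
    then have "transversal_presentation d E \<B> (image_mset ?S (mset_set {1..d}))"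
      using red S assms(1) B(1)
      by (intro transversal_presentation_image) (auto simp: subsets_of_card_def split: if_splits)
    moreover have "rel_mset (\<subseteq>) (image_mset ?S (mset_set {1..d})) (image_mset S (mset_set {1..d}))"
      by (rule rel_mset_image_subset) (auto split: if_splits)
    ultimately have "image_mset ?S (mset_set {1..d}) = image_mset S (mset_set {1..d})"
      using min unfolding minimal_transversal_presentation_def by blast
    \<comment> \<open>Equal multisets need not agree index by index, so the contradiction comes from
      the total of the cardinalities.\<close>
    then have "image_mset card (image_mset ?S (mset_set {1..d})) =
        image_mset card (image_mset S (mset_set {1..d}))"
      by (rule arg_cong)
    then have "(\<Sum>k\<in>{1..d}. card (?S k)) = (\<Sum>k\<in>{1..d}. card (S k))"
      unfolding multiset.map_comp sum_unfold_sum_mset by (simp add: comp_def)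
    moreover have "(\<Sum>k\<in>{1..d}. card (?S k)) < (\<Sum>k\<in>{1..d}. card (S k))"
    proof (rule sum_strict_mono_ex1)
      have "finite (S i)" using S[OF i] assms(1) finite_subset by blast
      then have "card (S i - {z}) < card (S i)" using z by (meson card_Diff1_less)
      then show "\<exists>k\<in>{1..d}. card (?S k) < card (S k)" "\<forall>k\<in>{1..d}. card (?S k) \<le> card (S k)"
        using i by auto
    qed simp
    ultimately show False by simp
  qed
next
  assume C: ?C
  show ?min
    unfolding minimal_transversal_presentation_def
  proof (intro conjI allI impI)
    show "transversal_presentation d E \<B> (image_mset S (mset_set {1..d}))"
      by (rule transversal_presentation_image) (use assms in auto)
  next
    fix \<A>' assume "transversal_presentation d E \<B> \<A>' \<and>
      rel_mset (\<subseteq>) \<A>' (image_mset S (mset_set {1..d}))"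
    then obtain F where F: "\<A>' = image_mset F (mset_set {1..d})"
        "\<B> = {B \<in> subsets_of_card d E. \<exists>\<phi>. bij_betw \<phi> B {1..d} \<and> (\<forall>b\<in>B. b \<in> F (\<phi> b))}"
      and rel: "rel_mset (\<subseteq>) (image_mset F (mset_set {1..d})) (image_mset S (mset_set {1..d}))"
      unfolding transversal_presentation_def by auto
    obtain p where p: "p permutes {1..d}" "\<And>i. i \<in> {1..d} \<Longrightarrow> F (p i) \<subseteq> S i"
      using rel_mset_subset_imageE[OF rel] by blast
    have "e \<in> F (p i)" if i: "i \<in> {1..d}" and e: "e \<in> S i" for i e
    proof -
      obtain J where J: "J \<subseteq> E - S i" "Suc (card J) = d" "matchable ({1..d} - {i}) S J"
        using C i by blast
      have "finite J" using J(1) assms(1) by (meson finite_Diff finite_subset)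
      then have "insert e J \<in> subsets_of_card d E"
        using J e S[OF i] by (auto simp: subsets_of_card_def card_insert_if)
      then have "insert e J \<in> \<B>"
        using matchable_insert[OF J(3) i e] B(1) by simp
      then obtain \<phi> where \<phi>: "bij_betw \<phi> (insert e J) {1..d}" "\<forall>b\<in>insert e J. b \<in> F (\<phi> b)"
        using F(2) by blast
      have "p i \<in> {1..d}" using p(1) i permutes_in_image by metis
      \<comment> \<open>The element taking row \<open>p i\<close> lies in \<open>F (p i)\<close>,
        hence in \<open>S i\<close>. Since \<open>J\<close> misses \<open>S i\<close>, it can only
        be \<open>e\<close>.\<close>
      then obtain b where b: "b \<in> insert e J" "\<phi> b = p i"
        using \<phi>(1) by (metis bij_betw_imp_surj_on imageE)
      then have "b \<in> F (p i)" using \<phi>(2) by force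
      moreover from this have "b \<in> S i" using p(2)[OF i] by blast
      ultimately show ?thesis using b J(1) by blast
    qed
    then have eq: "F (p i) = S i" if "i \<in> {1..d}" for i using p(2) that by blast
    have "image_mset F (mset_set {1..d}) = image_mset F (image_mset p (mset_set {1..d}))"
      using p(1) by (simp add: image_mset_mset_set permutes_inj_on permutes_image)
    also have "\<dots> = image_mset S (mset_set {1..d})"
      unfolding multiset.map_comp by (rule image_mset_cong) (use eq in auto)
    finally show "\<A>' = image_mset S (mset_set {1..d})" using F(1) by simp
  qed
qed

section \<open>The tropical Stiefel map\<close>

lemma sum_neq_Minfty:
  fixes f :: "'a \<Rightarrow> ereal"
  shows "(\<And>x. x \<in> A \<Longrightarrow> f x \<noteq> -\<infinity>) \<Longrightarrow> sum f A \<noteq> -\<infinity>"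
  by (induction A rule: infinite_finite_induct) auto

text \<open>Extensional maps keep this set finite, and \<open>card B = d\<close> makes it nonempty,
  as reasoning about \<open>Min\<close> requires.\<close>

definition assignments :: "nat \<Rightarrow> 'a set \<Rightarrow> ('a \<Rightarrow> nat) set" where
  "assignments d B = {\<phi> \<in> B \<rightarrow>\<^sub>E {1..d}. bij_betw \<phi> B {1..d}}"

lemma assignments_row: "\<phi> \<in> assignments d B \<Longrightarrow> b \<in> B \<Longrightarrow> \<phi> b \<in> {1..d}"
  unfolding assignments_def by (auto simp: bij_betw_def)

lemma stiefel_map_eq_Min:
  "stiefel_map d A B = Min ((\<lambda>\<phi>. \<Sum>i\<in>B. A (\<phi> i) i) ` assignments d B)"
  unfolding stiefel_map_def assignments_def by (rule arg_cong[of _ _ Min]) auto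

lemma finite_assignments: "finite B \<Longrightarrow> finite (assignments d B)"
  unfolding assignments_def by (rule finite_subset[of _ "B \<rightarrow>\<^sub>E {1..d}"]) (auto intro: finite_PiE)

lemma restrict_in_assignments: "bij_betw \<phi> B {1..d} \<Longrightarrow> restrict \<phi> B \<in> assignments d B"
  unfolding assignments_def by (auto simp: bij_betw_def inj_on_def)

lemma assignments_nonempty:
  assumes "finite B" "card B = d"
  shows "assignments d B \<noteq> {}"
proof -
  obtain \<phi> where "bij_betw \<phi> B {1..d}"
    using assms finite_same_card_bij[of B "{1..d}"] by auto
  then show ?thesis using restrict_in_assignments by blast
qed

text \<open>The minimum is below infinity iff some term is, and a term is infinite iff one of its
  entries is. Finiteness thus depends only on the supports.\<close>

lemma stiefel_map_finite_iff:
  assumes "finite B" "card B = d" "B \<subseteq> E"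
  shows "stiefel_map d A B \<noteq> \<infinity> \<longleftrightarrow> matchable {1..d} (\<lambda>i. vec_support E (A i)) B"
proof -
  have "stiefel_map d A B \<noteq> \<infinity> \<longleftrightarrow> (\<exists>\<phi>\<in>assignments d B. (\<Sum>i\<in>B. A (\<phi> i) i) \<noteq> \<infinity>)"
    unfolding stiefel_map_eq_Min ereal_infty_less(1)[symmetric]
    using finite_assignments[of B d] assignments_nonempty[of B d] assms
    by (subst Min_less_iff) auto
  also have "\<dots> \<longleftrightarrow> (\<exists>\<phi>\<in>assignments d B. \<forall>b\<in>B. b \<in> vec_support E (A (\<phi> b)))"
    using assms by (auto simp: sum_Pinfty vec_support_def)
  also have "\<dots> \<longleftrightarrow> (\<exists>\<phi>. bij_betw \<phi> B {1..d} \<and> (\<forall>b\<in>B. b \<in> vec_support E (A (\<phi> b))))"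
    (is "?l \<longleftrightarrow> ?r")
  proof
    assume ?r
    then obtain \<phi> where "bij_betw \<phi> B {1..d}" "\<forall>b\<in>B. b \<in> vec_support E (A (\<phi> b))" by blast
    then show ?l by (intro bexI[of _ "restrict \<phi> B"] restrict_in_assignments) auto
  qed (auto simp: assignments_def)
  finally show ?thesis
    using matchable_iff_bij_betw[of B "{1..d}" "\<lambda>i. vec_support E (A i)"] assms by simp
qed

lemma stiefel_map_trop:
  assumes "finite B" "card B = d" "\<And>i j. i \<in> {1..d} \<Longrightarrow> j \<in> B \<Longrightarrow> A i j \<noteq> -\<infinity>"
  shows "stiefel_map d A B \<noteq> -\<infinity>"
proof -
  have "stiefel_map d A B \<in> (\<lambda>\<phi>. \<Sum>i\<in>B. A (\<phi> i) i) ` assignments d B"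
    unfolding stiefel_map_eq_Min
    using finite_assignments[of B d] assignments_nonempty[of B d] assms by (intro Min_in) auto
  then obtain \<phi> where \<phi>: "\<phi> \<in> assignments d B" "stiefel_map d A B = (\<Sum>i\<in>B. A (\<phi> i) i)" by auto
  then show ?thesis unfolding \<phi>(2)
    by (intro sum_neq_Minfty assms(3) assignments_row[OF \<phi>(1)]) auto
qed

section \<open>The effect of an appended column\<close>

lemma stiefel_map_append_Some:
  "stiefel_map d (append_column A x) (Some ` B) = stiefel_map d (append_column A y) (Some ` B)"
proof -
  have "(\<Sum>i\<in>Some ` B. append_column A x (\<phi> i) i) = (\<Sum>i\<in>Some ` B. append_column A y (\<phi> i) i)" for \<phi>
    by (rule sum.cong) (auto simp: append_column_def)
  then show ?thesis by (simp add: stiefel_map_def)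
qed

lemma stiefel_map_append_None:
  assumes "finite J"
  shows "stiefel_map d (append_column A x) (insert None (Some ` J)) =
    Min ((\<lambda>\<phi>. x (\<phi> None) + (\<Sum>j\<in>J. A (\<phi> (Some j)) j)) ` assignments d (insert None (Some ` J)))"
  unfolding stiefel_map_eq_Min
  using assms by (simp add: append_column_def sum.reindex)

lemma extend_ground_subset_cases:
  assumes "B \<in> subsets_of_card d (extend_ground E)" "finite E"
  obtains B' where "B' \<subseteq> E" "card B' = d" "B = Some ` B'"
    | J where "J \<subseteq> E" "Suc (card J) = d" "B = insert None (Some ` J)"
proof -
  have B: "B \<subseteq> insert None (Some ` E)" "card B = d" "finite B"
    using assms by (auto simp: subsets_of_card_def extend_ground_def intro: finite_subset)
  define J where "J = {j. Some j \<in> B}"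
  have J: "J \<subseteq> E" using B by (auto simp: J_def)
  have fJ: "finite J" using J assms(2) finite_subset by blast
  have eq: "B - {None} = Some ` J"
  proof (rule set_eqI)
    show "b \<in> B - {None} \<longleftrightarrow> b \<in> Some ` J" for b by (cases b) (auto simp: J_def)
  qed
  show ?thesis
  proof (cases "None \<in> B")
    case True
    then have "B = insert None (Some ` J)" using eq by blast
    moreover from this have "Suc (card J) = d" using B fJ by (simp add: card_image)
    ultimately show ?thesis using that(2) J by blast
  next
    case False
    then have "B = Some ` J" using eq by simp
    moreover from this have "card J = d" using B by (simp add: card_image)
    ultimately show ?thesis using that(1) J by blast
  qed
qed

text \<open>Since \<open>\<pi>(A|x)\<close> restricted to \<open>E\<close> is \<open>\<pi>(A)\<close>, the additive constant has to vanish.\<close>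

lemma same_valuated_matroid_append_iff:
  assumes "finite E" "\<And>i j. i \<in> {1..d} \<Longrightarrow> j \<in> E \<Longrightarrow> A i j \<noteq> -\<infinity>"
    and B: "B \<subseteq> E" "card B = d" "stiefel_map d A B \<noteq> \<infinity>"
  shows "same_valuated_matroid d (extend_ground E)
      (stiefel_map d (append_column A x)) (stiefel_map d (append_column A y)) \<longleftrightarrow>
    (\<forall>J \<subseteq> E. Suc (card J) = d \<longrightarrow> stiefel_map d (append_column A x) (insert None (Some ` J)) =
       stiefel_map d (append_column A y) (insert None (Some ` J)))" (is "?l \<longleftrightarrow> ?r")
proof
  assume ?l
  then obtain c :: real where c: "\<forall>B\<in>subsets_of_card d (extend_ground E).
      stiefel_map d (append_column A x) B = stiefel_map d (append_column A y) B + ereal c"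
    unfolding same_valuated_matroid_def by blast
  let ?v = "stiefel_map d (append_column A y) (Some ` B)"
  have fB: "finite B" using B assms(1) finite_subset by blast
  have "matchable {1..d} (\<lambda>i. vec_support E (A i)) B"
    using stiefel_map_finite_iff[of B d E A] fB B by simp
  \<comment> \<open>Cancelling \<open>c\<close> requires \<open>?v\<close> to be finite; this is
    carried over from \<open>B\<close> through matchability.\<close>
  then have "matchable {1..d} (\<lambda>i. vec_support (Some ` E) (append_column A y i)) (Some ` B)"
    unfolding matchable_def
    by (elim exE) (rule_tac x = "f \<circ> the" in exI, auto simp: inj_on_def vec_support_def append_column_def)
  then have "?v \<noteq> \<infinity>"
    using stiefel_map_finite_iff[of "Some ` B" d "Some ` E"] fB B by (simp add: card_image image_mono)
  moreover have "?v \<noteq> -\<infinity>"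
    using fB B assms(2) by (intro stiefel_map_trop) (auto simp: card_image append_column_def)
  moreover have "Some ` B \<in> subsets_of_card d (extend_ground E)"
    using B by (auto simp: subsets_of_card_def extend_ground_def card_image)
  then have "?v = ?v + ereal c"
    using c stiefel_map_append_Some[of d A x B y] by metis
  ultimately have "c = 0" by (cases ?v) auto
  show ?r
  proof (intro allI impI)
    fix J assume J: "J \<subseteq> E" "Suc (card J) = d"
    then have "insert None (Some ` J) \<in> subsets_of_card d (extend_ground E)"
      using assms(1) by (auto simp: subsets_of_card_def extend_ground_def card_image card_insert_if
          finite_subset)
    then show "stiefel_map d (append_column A x) (insert None (Some ` J)) =
       stiefel_map d (append_column A y) (insert None (Some ` J))"
      using c \<open>c = 0\<close> by simp
  qed
next
  assume r: ?r
  show ?l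
    unfolding same_valuated_matroid_def
  proof (intro exI[of _ 0] ballI)
    fix B assume "B \<in> subsets_of_card d (extend_ground E)"
    from this assms(1) show "stiefel_map d (append_column A x) B =
        stiefel_map d (append_column A y) B + ereal 0"
      by (cases rule: extend_ground_subset_cases) (use r stiefel_map_append_Some in auto)
  qed
qed

text \<open>If the \<open>i\<close>-th row is \<open>\<infinity>\<close> on \<open>J\<close>, only assignments \<open>\<phi>\<close> with \<open>\<phi> * = i\<close> contribute.\<close>

lemma append_column_determined:
  assumes J: "finite J" "Suc (card J) = d" "i \<in> {1..d}"
    and inf: "\<And>j. j \<in> J \<Longrightarrow> A i j = \<infinity>"
    and tr: "\<And>k j. k \<in> {1..d} \<Longrightarrow> j \<in> J \<Longrightarrow> A k j \<noteq> -\<infinity>"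
    and m: "matchable ({1..d} - {i}) (\<lambda>k. vec_support E (A k)) J"
    and x: "\<And>k. k \<in> {1..d} \<Longrightarrow> x k \<noteq> -\<infinity>" and y: "\<And>k. k \<in> {1..d} \<Longrightarrow> y k \<noteq> -\<infinity>"
    and eq: "stiefel_map d (append_column A x) (insert None (Some ` J)) =
       stiefel_map d (append_column A y) (insert None (Some ` J))"
  shows "x i = y i"
proof -
  let ?B = "insert None (Some ` J)"
  let ?P = "assignments d ?B"
  define s where "s \<phi> = (\<Sum>j\<in>J. A (\<phi> (Some j)) j)" for \<phi> :: "_ \<Rightarrow> nat"
  have cB: "card ?B = d" using J by (simp add: card_image)
  have P: "finite (s ` ?P)" "s ` ?P \<noteq> {}"
    using finite_assignments[of ?B d] assignments_nonempty[of ?B d] cB J by auto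
  have sM: "s \<phi> \<noteq> -\<infinity>" if "\<phi> \<in> ?P" for \<phi>
    unfolding s_def using that tr by (intro sum_neq_Minfty tr assignments_row) auto
  \<comment> \<open>Terms with another row at \<open>None\<close> are infinite because row
    \<open>i\<close> then meets \<open>J\<close>, so \<open>u i\<close> may replace their first
    summand and comes out of the minimum.\<close>
  have val: "stiefel_map d (append_column A u) ?B = u i + Min (s ` ?P)"
    if u: "\<And>k. k \<in> {1..d} \<Longrightarrow> u k \<noteq> -\<infinity>" for u
  proof -
    have "u (\<phi> None) + s \<phi> = u i + s \<phi>" if \<phi>: "\<phi> \<in> ?P" for \<phi>
    proof (cases "\<phi> None = i")
      case False
      have "i \<in> \<phi> ` ?B" using \<phi> J(3) by (auto simp: assignments_def bij_betw_def)
      then obtain j where "j \<in> J" "\<phi> (Some j) = i" using False by auto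
      then have "s \<phi> = \<infinity>" using inf J(1) by (auto simp: s_def sum_Pinfty)
      then show ?thesis by simp
    qed simp
    then have "stiefel_map d (append_column A u) ?B = Min ((\<lambda>\<phi>. u i + s \<phi>) ` ?P)"
      unfolding stiefel_map_append_None[OF J(1)] s_def[symmetric] by (simp cong: image_cong)
    also have "\<dots> = Min ((\<lambda>t. u i + t) ` s ` ?P)" by (simp add: image_image)
    also have "\<dots> = u i + Min (s ` ?P)"
      using P by (intro mono_Min_commute[symmetric]) (auto intro: monoI add_left_mono)
    finally show ?thesis .
  qed
  have "\<exists>\<phi>\<in>?P. s \<phi> \<noteq> \<infinity>"
  proof -
    obtain f where f: "inj_on f J" "\<forall>j\<in>J. f j \<in> {1..d} - {i} \<and> j \<in> vec_support E (A (f j))"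
      using m unfolding matchable_def by blast
    \<comment> \<open>Sending the new element to the free row \<open>i\<close> completes the
      matching of \<open>J\<close>. The minimum of \<open>s\<close> is therefore a real number and
      cancels.\<close>
    define g where "g = case_option i f"
    have "inj_on g ?B" using f by (auto simp: inj_on_def g_def)
    moreover from this have "g ` ?B = {1..d}"
      using f J cB by (intro card_subset_eq) (auto simp: g_def card_image)
    ultimately have "restrict g ?B \<in> ?P" by (intro restrict_in_assignments) (simp add: bij_betw_def)
    moreover have "s (restrict g ?B) \<noteq> \<infinity>"
      using f J(1) by (auto simp: s_def sum_Pinfty g_def vec_support_def)
    ultimately show ?thesis by blast
  qed
  then have "Min (s ` ?P) \<noteq> \<infinity>"
    using P by (metis Min_le ereal_infty_less_eq(1) imageI)
  moreover have "Min (s ` ?P) \<noteq> -\<infinity>"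
    using Min_in[OF P] sM by (metis imageE)
  moreover have "x i + Min (s ` ?P) = y i + Min (s ` ?P)" using eq val x y by metis
  ultimately show ?thesis
    by (cases "Min (s ` ?P)"; cases "x i"; cases "y i") auto
qed

text \<open>\<open>M\<close> sums the absolute values of all entries, infinite ones counting 0 under
  \<open>real_of_ereal\<close>. Two finite entries differ by at most \<open>2 * M\<close>, and an
  infinite \<open>A k j\<close> is harmless on the right.\<close>

lemma finite_entries_bound:
  fixes A :: "nat \<Rightarrow> 'a \<Rightarrow> ereal"
  assumes "finite E" and tr: "\<And>i j. i \<in> {1..d} \<Longrightarrow> j \<in> E \<Longrightarrow> A i j \<noteq> -\<infinity>"
  shows "\<exists>L::real. \<forall>i\<in>{1..d}. \<forall>k\<in>{1..d}. \<forall>j\<in>E. A i j \<noteq> \<infinity> \<longrightarrow> A i j \<le> ereal L + A k j"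
proof -
  define a where "a p = \<bar>real_of_ereal (A (fst p) (snd p))\<bar>" for p
  define M where "M = (\<Sum>p\<in>{1..d} \<times> E. a p)"
  have le: "\<bar>real_of_ereal (A i j)\<bar> \<le> M" if "i \<in> {1..d}" "j \<in> E" for i j
  proof -
    have "a (i, j) \<le> M"
      unfolding M_def by (rule member_le_sum) (use that assms(1) in \<open>simp_all add: a_def real_of_ereal_pos\<close>)
    then show ?thesis by (simp add: a_def)
  qed
  show ?thesis
  proof (intro exI[of _ "2 * M"] ballI impI)
    fix i k j assume *: "i \<in> {1..d}" "k \<in> {1..d}" "j \<in> E" "A i j \<noteq> \<infinity>"
    then show "A i j \<le> ereal (2 * M) + A k j"
      using le[OF *(1,3)] le[OF *(2,3)] tr[OF *(1,3)] tr[OF *(2,3)]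
      by (cases "A i j"; cases "A k j") auto
  qed
qed

text \<open>An assignment with \<open>\<phi> * = i\<close> can be rerouted through an element of \<open>J\<close> in the support of
  row \<open>i\<close>, at a cost bounded by the constant \<open>L\<close>; so the value \<open>x i \<ge> L\<close> is never needed.\<close>

lemma append_column_not_determined:
  fixes A :: "nat \<Rightarrow> 'a \<Rightarrow> ereal"
  assumes J: "finite J" "Suc (card J) = d" "J \<subseteq> E"
    and L: "\<And>i k j. i \<in> {1..d} \<Longrightarrow> k \<in> {1..d} \<Longrightarrow> j \<in> E \<Longrightarrow> A i j \<noteq> \<infinity> \<Longrightarrow> A i j \<le> ereal L + A k j"
    and i: "i \<in> {1..d}"
    and no: "J \<subseteq> E - vec_support E (A i) \<Longrightarrow>
      \<not> matchable ({1..d} - {i}) (\<lambda>k. vec_support E (A k)) J"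
    and x: "\<And>k. k \<in> {1..d} \<Longrightarrow> x k = (if k = i then \<infinity> else 0)"
    and y: "\<And>k. k \<in> {1..d} \<Longrightarrow> y k = (if k = i then ereal L else 0)"
  shows "stiefel_map d (append_column A x) (insert None (Some ` J)) =
       stiefel_map d (append_column A y) (insert None (Some ` J))"
proof -
  let ?B = "insert None (Some ` J)"
  let ?P = "assignments d ?B"
  define s where "s \<phi> = (\<Sum>j\<in>J. A (\<phi> (Some j)) j)" for \<phi> :: "_ \<Rightarrow> nat"
  have cB: "card ?B = d" using J by (simp add: card_image)
  have P: "finite ?P" "?P \<noteq> {}"
    using finite_assignments[of ?B d] assignments_nonempty[of ?B d] cB J by auto
  have row: "\<phi> b \<in> {1..d}" if "\<phi> \<in> ?P" "b \<in> ?B" for \<phi> b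
    using that by (rule assignments_row)
  \<comment> \<open>Easy direction: \<open>y\<close> is at most \<open>x\<close> in every
    row.\<close>
  have "Min ((\<lambda>\<phi>. y (\<phi> None) + s \<phi>) ` ?P) \<le> Min ((\<lambda>\<phi>. x (\<phi> None) + s \<phi>) ` ?P)"
  proof (rule Min.boundedI)
    fix t assume "t \<in> (\<lambda>\<phi>. x (\<phi> None) + s \<phi>) ` ?P"
    then obtain \<phi> where \<phi>: "\<phi> \<in> ?P" "t = x (\<phi> None) + s \<phi>" by auto
    have "y (\<phi> None) \<le> x (\<phi> None)" using x y row[OF \<phi>(1), of None] by simp
    then have "y (\<phi> None) + s \<phi> \<le> t" using \<phi>(2) by (simp add: add_right_mono)
    then show "Min ((\<lambda>\<phi>. y (\<phi> None) + s \<phi>) ` ?P) \<le> t"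
      using P \<phi>(1) by (meson Min_le finite_imageI image_eqI order_trans)
  qed (use P in auto)
  moreover have "Min ((\<lambda>\<phi>. x (\<phi> None) + s \<phi>) ` ?P) \<le> Min ((\<lambda>\<phi>. y (\<phi> None) + s \<phi>) ` ?P)"
  proof (rule Min.boundedI)
    fix t assume "t \<in> (\<lambda>\<phi>. y (\<phi> None) + s \<phi>) ` ?P"
    then obtain \<phi> where \<phi>: "\<phi> \<in> ?P" "t = y (\<phi> None) + s \<phi>" by auto
    have "\<exists>\<psi>\<in>?P. x (\<psi> None) + s \<psi> \<le> t"
    proof (cases "\<phi> None = i \<and> s \<phi> \<noteq> \<infinity>")
      \<comment> \<open>Either the term is infinite, or it avoids \<open>x i\<close> and
        \<open>y i\<close>; in both cases \<open>\<phi>\<close> itself serves as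
        \<open>\<psi>\<close>.\<close>
      case False
      moreover have "t = \<infinity>" if "s \<phi> = \<infinity>" using that \<phi> by simp
      moreover have "x (\<phi> None) + s \<phi> = t" if "\<phi> None \<noteq> i"
        using that \<phi> x y row[OF \<phi>(1), of None] by simp
      ultimately show ?thesis using \<phi>(1) by (metis ereal_less_eq(1) order_refl)
    next
      case True
      have inj: "inj_on \<phi> ?B" using \<phi>(1) by (auto simp: assignments_def bij_betw_def)
      have ne: "\<phi> (Some j) \<noteq> i" if "j \<in> J" for j
        using inj True that by (auto simp: inj_on_def)
      have fin: "A (\<phi> (Some j)) j \<noteq> \<infinity>" if "j \<in> J" for j
        using True that J(1) by (auto simp: s_def sum_Pinfty)
      have "matchable ({1..d} - {i}) (\<lambda>k. vec_support E (A k)) J"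
        unfolding matchable_def
      proof (intro exI[of _ "\<phi> \<circ> Some"] conjI ballI)
        show "inj_on (\<phi> \<circ> Some) J" using inj by (auto simp: inj_on_def)
      qed (use ne fin row[OF \<phi>(1)] J(3) in \<open>auto simp: vec_support_def\<close>)
      \<comment> \<open>\<open>\<phi>\<close> matches \<open>J\<close> without row \<open>i\<close>,
        so by \<open>no\<close> the set \<open>J\<close> must meet the support of row
        \<open>i\<close>.\<close>
      then obtain j where j: "j \<in> J" "A i j \<noteq> \<infinity>"
        using no J(3) by (auto simp: vec_support_def)
      \<comment> \<open>Exchanges the rows of the new element and \<open>j\<close>. Only the entry
        in column \<open>j\<close> changes inside \<open>s\<close>, at a cost of at most
        \<open>L\<close>, exactly what \<open>y i\<close> contributed to \<open>t\<close>.\<close>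
      define \<psi> where "\<psi> = \<phi>(None := \<phi> (Some j), Some j := i)"
      have "bij_betw (\<phi> \<circ> transpose None (Some j)) ?B {1..d}"
        using \<phi>(1) j(1) by (intro bij_betw_trans[of _ ?B ?B]) (auto simp: assignments_def)
      then have "bij_betw \<psi> ?B {1..d}"
        by (rule bij_betw_cong[THEN iffD1, rotated]) (auto simp: \<psi>_def True transpose_def)
      moreover have "\<psi> \<in> ?B \<rightarrow>\<^sub>E {1..d}"
        using \<phi>(1) j(1) i by (auto simp: assignments_def \<psi>_def PiE_def Pi_def extensional_def)
      ultimately have \<psi>: "\<psi> \<in> ?P" by (simp add: assignments_def)
      have "x (\<psi> None) = 0" using ne[OF j(1)] x row[OF \<phi>(1), of "Some j"] j(1) by (simp add: \<psi>_def)
      have "s \<psi> = A i j + (\<Sum>k\<in>J - {j}. A (\<phi> (Some k)) k)"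
        using J(1) j(1) by (simp add: s_def \<psi>_def sum.remove[of J j])
      also have "\<dots> \<le> ereal L + A (\<phi> (Some j)) j + (\<Sum>k\<in>J - {j}. A (\<phi> (Some k)) k)"
        using L[OF i _ _ j(2)] row[OF \<phi>(1), of "Some j"] j(1) J(3) by (intro add_right_mono) auto
      also have "\<dots> = ereal L + s \<phi>"
        using J(1) j(1) by (simp add: s_def sum.remove[of J j] add.assoc)
      also have "\<dots> = t" using \<phi>(2) y i True by simp
      finally show ?thesis using \<psi> \<open>x (\<psi> None) = 0\<close> by (intro bexI[of _ \<psi>]) simp_all
    qed
    then show "Min ((\<lambda>\<phi>. x (\<phi> None) + s \<phi>) ` ?P) \<le> t"
      using P by (meson Min_le finite_imageI image_eqI order_trans)
  qed (use P in auto)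
  ultimately show ?thesis
    unfolding stiefel_map_append_None[OF J(1)] s_def[symmetric] by (rule antisym[rotated])
qed

section \<open>The equivalence for matrix presentations\<close>

theorem theorem4p3:
  fixes E :: "'a set" and d :: nat
    and A :: "nat \<Rightarrow> 'a \<Rightarrow> ereal" and \<mu> :: "'a set \<Rightarrow> ereal"
  assumes "finite E" and "d \<ge> 1"
    and "valuated_matroid d E \<mu>"
    and "matrix_presentation d E A \<mu>"
  shows "(\<forall>x \<in> {1..d} \<rightarrow>\<^sub>E trop. \<forall>y \<in> {1..d} \<rightarrow>\<^sub>E trop. x \<noteq> y \<longrightarrow>
            \<not> same_valuated_matroid d (extend_ground E)
                (stiefel_map d (append_column A x)) (stiefel_map d (append_column A y)))
         \<longleftrightarrow> minimal_matrix_presentation d E A \<mu>"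
proof -
  let ?S = "\<lambda>i. vec_support E (A i)"
  let ?same = "\<lambda>x y. same_valuated_matroid d (extend_ground E)
                (stiefel_map d (append_column A x)) (stiefel_map d (append_column A y))"
  have tr: "A i j \<noteq> -\<infinity>" if "i \<in> {1..d}" "j \<in> E" for i j
    using assms(4) that by (auto simp: matrix_presentation_def trop_def)
  obtain c :: real where c: "\<forall>B\<in>subsets_of_card d E. stiefel_map d A B = \<mu> B + ereal c"
    using assms(4) by (auto simp: matrix_presentation_def same_valuated_matroid_def)
  have iff: "\<mu> B \<noteq> \<infinity> \<longleftrightarrow> matchable {1..d} ?S B" if "B \<in> subsets_of_card d E" for B
  proof -
    have "\<mu> B \<noteq> \<infinity> \<longleftrightarrow> stiefel_map d A B \<noteq> \<infinity>" using c that by (cases "\<mu> B") auto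
    also have "\<dots> \<longleftrightarrow> matchable {1..d} ?S B"
      using that assms(1) by (intro stiefel_map_finite_iff) (auto simp: subsets_of_card_def finite_subset)
    finally show ?thesis .
  qed
  then have bases: "underlying_bases d E \<mu> = {B \<in> subsets_of_card d E. matchable {1..d} ?S B}"
    by (auto simp: underlying_bases_def)
  have ne: "underlying_bases d E \<mu> \<noteq> {}"
    using assms(3) by (auto simp: valuated_matroid_def matroid_bases_def)
  \<comment> \<open>A basis provides the finite value that rules out a nonzero additive constant
    between two extensions.\<close>
  then obtain B0 where "B0 \<in> subsets_of_card d E" "\<mu> B0 \<noteq> \<infinity>" by (auto simp: underlying_bases_def)
  then have B0: "B0 \<subseteq> E" "card B0 = d" "stiefel_map d A B0 \<noteq> \<infinity>"
    using c by (auto simp: subsets_of_card_def)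
  have same_iff: "?same x y \<longleftrightarrow>
      (\<forall>J \<subseteq> E. Suc (card J) = d \<longrightarrow> stiefel_map d (append_column A x) (insert None (Some ` J)) =
         stiefel_map d (append_column A y) (insert None (Some ` J)))" for x y
    by (rule same_valuated_matroid_append_iff[OF assms(1) _ B0]) (rule tr)
  define C where "C i \<longleftrightarrow> (\<exists>J \<subseteq> E - ?S i. Suc (card J) = d \<and> matchable ({1..d} - {i}) ?S J)" for i
  have min: "minimal_matrix_presentation d E A \<mu> \<longleftrightarrow> (\<forall>i\<in>{1..d}. C i)"
    unfolding minimal_matrix_presentation_def C_def
    using assms(4) minimal_transversal_presentation_iff[of E d ?S, OF assms(1) _ bases ne]
    by (auto simp: vec_support_def)
  show ?thesis
    unfolding min
  proof (intro iffI ballI impI notI)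
    fix i assume inj: "\<forall>x \<in> {1..d} \<rightarrow>\<^sub>E trop. \<forall>y \<in> {1..d} \<rightarrow>\<^sub>E trop. x \<noteq> y \<longrightarrow> \<not> ?same x y"
      and i: "i \<in> {1..d}"
    show "C i"
    proof (rule ccontr)
      assume notC: "\<not> C i"
      have "\<exists>L::real. \<forall>i\<in>{1..d}. \<forall>k\<in>{1..d}. \<forall>j\<in>E. A i j \<noteq> \<infinity> \<longrightarrow> A i j \<le> ereal L + A k j"
        using assms(1) tr by (rule finite_entries_bound)
      then obtain L :: real where L: "\<And>i k j. i \<in> {1..d} \<Longrightarrow> k \<in> {1..d} \<Longrightarrow> j \<in> E \<Longrightarrow>
          A i j \<noteq> \<infinity> \<Longrightarrow> A i j \<le> ereal L + A k j"
        by (elim exE) blast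
      \<comment> \<open>The two columns differ only in row \<open>i\<close>, with infinity against
        \<open>L\<close>. When \<open>C i\<close> fails, rerouting makes both values
        invisible.\<close>
      define x where "x = restrict (\<lambda>k. if k = i then \<infinity> else 0 :: ereal) {1..d}"
      define y where "y = restrict (\<lambda>k. if k = i then ereal L else 0) {1..d}"
      have "?same x y"
        unfolding same_iff
      proof (intro allI impI)
        fix J assume J: "J \<subseteq> E" "Suc (card J) = d"
        show "stiefel_map d (append_column A x) (insert None (Some ` J)) =
            stiefel_map d (append_column A y) (insert None (Some ` J))"
        proof (rule append_column_not_determined[OF _ J(2,1) L i])
          show "finite J" using J(1) assms(1) finite_subset by blast
          show "\<not> matchable ({1..d} - {i}) ?S J" if "J \<subseteq> E - ?S i"
            using notC that J(2) unfolding C_def by blast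
        qed (auto simp: x_def y_def)
      qed
      moreover have "x i \<noteq> y i" using i by (simp add: x_def y_def)
      moreover have "x \<in> {1..d} \<rightarrow>\<^sub>E trop" "y \<in> {1..d} \<rightarrow>\<^sub>E trop"
        by (auto simp: x_def y_def trop_def)
      ultimately show False using inj by metis
    qed
  next
    fix x y assume C: "\<forall>i\<in>{1..d}. C i" and x: "x \<in> {1..d} \<rightarrow>\<^sub>E trop" and y: "y \<in> {1..d} \<rightarrow>\<^sub>E trop"
      and "x \<noteq> y" and same: "?same x y"
    \<comment> \<open>Columns are extensional, so distinct ones differ in an actual row; the set
      \<open>J\<close> for that row recovers its entry.\<close>
    then obtain i where i: "i \<in> {1..d}" "x i \<noteq> y i" by (meson PiE_ext)
    then obtain J where J: "J \<subseteq> E - ?S i" "Suc (card J) = d" "matchable ({1..d} - {i}) ?S J"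
      using C i(1) unfolding C_def by blast
    have "x i = y i"
    proof (rule append_column_determined[OF _ J(2) i(1) _ _ J(3)])
      show "finite J" using J(1) assms(1) by (meson finite_Diff finite_subset)
      show "stiefel_map d (append_column A x) (insert None (Some ` J)) =
          stiefel_map d (append_column A y) (insert None (Some ` J))"
        using same J(1,2) unfolding same_iff by blast
    qed (use J(1) tr x y in \<open>auto simp: vec_support_def trop_def PiE_def Pi_def\<close>)
    then show False using i by simp
  qed
qed

end
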